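(* Let $x,y\in\Omega$. For every $0\le s\le t\le 1$ and every $0\le\lambda\le1$, $$\bigl(x\,\#_{\mathrm{cv},s}\,y\bigr)\,\#_{\mathrm{cv},\lambda}\,\bigl(x\,\#_{\mathrm{cv},t}\,y\bigr)=x\,\#_{\mathrm{cv},(1-\lambda)s+\lambda t}\,y.$$ In particular, writing $\#_{\mathrm{cv}}=\#_{\mathrm{cv},1/2}$, $$\bigl(x\,\#_{\mathrm{cv},s}\,y\bigr)\,\#_{\mathrm{cv}}\,\bigl(x\,\#_{\mathrm{cv},t}\,y\bigr)=x\,\#_{\mathrm{cv},(s+t)/2}\,y.$$ Hence $x\,\#_{\mathrm{cv},t}\,y=x\,\#_{\mathrm{cv}}\,\bigl(x\,\#_{\mathrm{cv},2t}\,y\bigr)$ for $0\le t\le\frac12$, and $x\,\#_{\mathrm{cv},t}\,y=\bigl(x\,\#_{\mathrm{cv},2t-1}\,y\bigr)\,\#_{\mathrm{cv}}\,y$ for $\frac12\le t\le1$.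
   Context: Let $V\subset \mathrm{Sym}(3,\mathbb{R})$ be the 5-dimensional space of real symmetric $3\times3$ matrices whose $(1,2)$ and $(2,1)$ entries are $0$, and let $\Omega\subset V$ be the open cone of positive definite matrices in $V$. Let $H$ be the group of real lower triangular $3\times 3$ matrices with positive diagonal entries and zero $(2,1)$ entry. The map $\Phi:H\to\Omega$, $\Phi(T)=TT^{\top}$, is a diffeomorphism; for $x\in\Omega$, $T_x:=\Phi^{-1}(x)\in H$ is the lower Cholesky factor of $x$. For $T\in H$ and $t\in\mathbb{R}$, $T^t:=\exp(t\log T)\in H$, where $\log$ is the principal matrix logarithm. For $x,y\in\Omega$ and $0\le t\le 1$, the weighted Cholesky-Vinberg mean is $x\,\#_{\mathrm{cv},t}\,y:=\Phi\bigl(T_x(T_x^{-1}T_y)^t\bigr)$. *)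

theory Defs
  imports "HOL-Analysis.Analysis"
begin

definition matrix_exp :: "real^'n^'n \<Rightarrow> real^'n^'n" where
  "matrix_exp A = (\<Sum>k. (((**) A) ^^ k) (mat 1) /\<^sub>R fact k)"

definition complex_matrix :: "real^'n^'m \<Rightarrow> complex^'n^'m" where
  "complex_matrix A = (\<chi> i j. complex_of_real (A $ i $ j))"

definition matrix_eigenvalue :: "complex^'n^'n \<Rightarrow> complex \<Rightarrow> bool" where
  "matrix_eigenvalue A z \<longleftrightarrow> (\<exists>v. v \<noteq> 0 \<and> A *v v = z *s v)"

text \<open>The principal logarithm of a matrix without eigenvalues on the closed negative real axis is
  its unique logarithm with spectrum in the open strip of complex numbers with imaginary part
  strictly between \<open>-\<pi>\<close> and \<open>\<pi>\<close>. For a real matrix it is real, so only real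
  logarithms are considered; their spectrum is nevertheless the complex one.\<close>

definition is_principal_log :: "real^'n^'n \<Rightarrow> real^'n^'n \<Rightarrow> bool" where
  "is_principal_log A L \<longleftrightarrow>
     matrix_exp L = A \<and> (\<forall>z. matrix_eigenvalue (complex_matrix L) z \<longrightarrow> \<bar>Im z\<bar> < pi)"

definition matrix_log :: "real^'n^'n \<Rightarrow> real^'n^'n" where
  "matrix_log A = (THE L. is_principal_log A L)"

definition matrix_rpow :: "real^'n^'n \<Rightarrow> real \<Rightarrow> real^'n^'n" where
  "matrix_rpow A t = matrix_exp (t *\<^sub>R matrix_log A)"

definition pos_def_matrix :: "real^'n^'n \<Rightarrow> bool" where
  "pos_def_matrix A \<longleftrightarrow> transpose A = A \<and> (\<forall>v. v \<noteq> 0 \<longrightarrow> v \<bullet> (A *v v) > 0)"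

definition V_space :: "(real^3^3) set" where
  "V_space = {A. transpose A = A \<and> A $ 1 $ 2 = 0 \<and> A $ 2 $ 1 = 0}"

definition Omega :: "(real^3^3) set" where
  "Omega = {A \<in> V_space. pos_def_matrix A}"

text \<open>The entries are listed individually because in the index type \<open>3\<close> the numeral \<open>3\<close> equals \<open>0\<close>,
  so the order of that type is not the order of the row and column numbers.\<close>

definition H_group :: "(real^3^3) set" where
  "H_group = {T. T $ 1 $ 2 = 0 \<and> T $ 1 $ 3 = 0 \<and> T $ 2 $ 3 = 0 \<and> T $ 2 $ 1 = 0 \<and>
                 T $ 1 $ 1 > 0 \<and> T $ 2 $ 2 > 0 \<and> T $ 3 $ 3 > 0}"

definition Phi :: "real^3^3 \<Rightarrow> real^3^3" where
  "Phi T = T ** transpose T"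

definition chol :: "real^3^3 \<Rightarrow> real^3^3" where
  "chol x = inv_into H_group Phi x"

definition cv_wmean :: "real \<Rightarrow> real^3^3 \<Rightarrow> real^3^3 \<Rightarrow> real^3^3" where
  "cv_wmean t x y = Phi (chol x ** matrix_rpow (matrix_inv (chol x) ** chol y) t)"

abbreviation cv_mean :: "real^3^3 \<Rightarrow> real^3^3 \<Rightarrow> real^3^3" where
  "cv_mean \<equiv> cv_wmean (1/2)"

end

theory Submission
  imports Defs "HOL-Computational_Algebra.Fundamental_Theorem_Algebra"
begin

text \<open>With \<open>X\<close>, \<open>Y\<close> the Cholesky factors of \<open>x\<close>, \<open>y\<close> and \<open>Z = X\<^sup>-\<^sup>1 Y\<close>, the mean with weight
  \<open>t\<close> has Cholesky factor \<open>X Z\<^sup>t\<close>, so everything follows from \<open>Z\<^sup>s Z\<^sup>t = Z\<^sup>s\<^sup>+\<^sup>t\<close> and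
  \<open>(Z\<^sup>s)\<^sup>t = Z\<^sup>s\<^sup>t\<close>. The exponential maps the Lie algebra of \<open>H\<close> onto \<open>H\<close> and is explicit there.
  The real issue is that a principal logarithm \<open>L\<close> of a matrix of \<open>H\<close>, which competes among all
  real matrices, lies in that Lie algebra. The first two unit rows are left eigenvectors of
  \<open>exp L\<close>; because the spectrum of \<open>L\<close> lies in the strip they are left eigenvectors of \<open>L\<close>,
  which forces the shape of \<open>L\<close>.\<close>

section \<open>Entrywise convergence of the matrix exponential\<close>

lemma vec_sums_iff:
  fixes f :: "nat \<Rightarrow> 'a::real_normed_vector^'n"
  shows "f sums l \<longleftrightarrow> (\<forall>i. (\<lambda>k. f k $ i) sums (l $ i))"
proof
  assume "f sums l"
  then show "\<forall>i. (\<lambda>k. f k $ i) sums (l $ i)"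
    unfolding sums_def by (auto dest: tendsto_vec_nth simp: sum_component)
next
  assume "\<forall>i. (\<lambda>k. f k $ i) sums (l $ i)"
  then show "f sums l"
    unfolding sums_def by (auto intro!: vec_tendstoI simp: sum_component)
qed

text \<open>Each absolute row sum of \<open>A\<close> is at most the sum over all entries, so every
  further factor costs at most that sum. The matrix series is thereby dominated by a scalar
  exponential series.\<close>

lemma abs_matrix_power_entry_le:
  fixes A :: "real^'n^'n"
  shows "\<bar>((((**) A) ^^ k) (mat 1)) $ i $ j\<bar> \<le> (\<Sum>i\<in>UNIV. \<Sum>j\<in>UNIV. \<bar>A $ i $ j\<bar>) ^ k"
    (is "_ \<le> ?C ^ k")
proof (induction k arbitrary: i j)
  case 0
  then show ?case by (simp add: mat_def)
next
  case (Suc k)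
  have "\<bar>((((**) A) ^^ Suc k) (mat 1)) $ i $ j\<bar> \<le> (\<Sum>m\<in>UNIV. \<bar>A $ i $ m * ((((**) A) ^^ k) (mat 1)) $ m $ j\<bar>)"
    by (simp add: matrix_matrix_mult_def sum_abs)
  also have "\<dots> \<le> (\<Sum>m\<in>UNIV. \<bar>A $ i $ m\<bar> * ?C ^ k)"
    by (intro sum_mono) (simp add: abs_mult mult_left_mono Suc)
  also have "\<dots> = (\<Sum>m\<in>UNIV. \<bar>A $ i $ m\<bar>) * ?C ^ k"
    by (simp add: sum_distrib_right)
  also have "\<dots> \<le> ?C * ?C ^ k"
    by (intro mult_right_mono member_le_sum zero_le_power sum_nonneg) auto
  finally show ?case by simp
qed

lemma matrix_exp_sums:
  fixes A :: "real^'n^'n"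
  shows "(\<lambda>k. (((**) A) ^^ k) (mat 1) /\<^sub>R fact k) sums matrix_exp A"
proof -
  let ?t = "\<lambda>k. (((**) A) ^^ k) (mat 1) /\<^sub>R fact k"
  let ?C = "\<Sum>i\<in>UNIV. \<Sum>j\<in>UNIV. \<bar>A $ i $ j\<bar>"
  have "summable (\<lambda>k. ?t k $ i $ j)" for i j
  proof (rule summable_comparison_test)
    show "summable (\<lambda>k. inverse (fact k) * ?C ^ k)"
      by (rule summable_exp)
    show "\<exists>N. \<forall>k\<ge>N. norm (?t k $ i $ j) \<le> inverse (fact k) * ?C ^ k"
      by (simp add: abs_mult mult_left_mono abs_matrix_power_entry_le)
  qed
  then have "?t sums (\<chi> i j. \<Sum>k. ?t k $ i $ j)"
    by (simp add: vec_sums_iff summable_sums)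
  then show ?thesis
    unfolding matrix_exp_def by (rule summable_sums[OF sums_summable])
qed

lemma matrix_exp_sums_iff:
  "matrix_exp A = B \<longleftrightarrow> (\<forall>i j. (\<lambda>k. ((((**) A) ^^ k) (mat 1)) $ i $ j / fact k) sums (B $ i $ j))"
proof -
  have "matrix_exp A = B \<longleftrightarrow> (\<lambda>k. (((**) A) ^^ k) (mat 1) /\<^sub>R fact k) sums B"
    using matrix_exp_sums sums_unique2 by blast
  then show ?thesis
    by (simp add: vec_sums_iff divide_inverse mult.commute)
qed

section \<open>Polynomials in a matrix acting on row vectors\<close>

text \<open>This is the row \<open>v p(M)\<close>, evaluated by Horner's rule without forming the
  matrix \<open>p(M)\<close>.\<close>

definition poly_row :: "complex poly \<Rightarrow> complex^'n^'n \<Rightarrow> complex^'n \<Rightarrow> complex^'n" where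
  "poly_row p M v = fold_coeffs (\<lambda>a w. a *s v + w v* M) p 0"

lemma poly_row_0 [simp]: "poly_row 0 M v = 0"
  by (simp add: poly_row_def)

lemma poly_row_pCons [simp]: "poly_row (pCons a p) M v = a *s v + poly_row p M v v* M"
  by (cases "a = 0 \<and> p = 0") (auto simp: poly_row_def fold_coeffs_def cCons_def)

lemma poly_row_add: "poly_row (p + q) M v = poly_row p M v + poly_row q M v"
  by (induction p q rule: poly_induct2) (simp_all add: algebra_simps vector_sadd_rdistrib)

lemma poly_row_smult: "poly_row (smult c p) M v = c *s poly_row p M v"
  by (induction p) (simp_all add: vector_add_ldistrib vector_smult_assoc scalar_vector_matrix_assoc)

lemma poly_row_sum: "poly_row (\<Sum>i\<in>I. g i) M v = (\<Sum>i\<in>I. poly_row (g i) M v)"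
  by (induction I rule: infinite_finite_induct) (simp_all add: poly_row_add)

lemma poly_row_monom: "poly_row (monom a k) M v = a *s (((\<lambda>w. w v* M) ^^ k) v)"
  by (induction k) (simp_all add: monom_0 monom_Suc scalar_vector_matrix_assoc)

text \<open>If the product annihilates \<open>v\<close>, then \<open>q\<close> sends
  \<open>v\<close> to zero or to a left eigenvector for \<open>z\<close>.\<close>

lemma poly_row_linear_factor:
  "poly_row ([:- z, 1:] * q) M v = poly_row q M v v* M - z *s poly_row q M v"
proof -
  have "[:- z, 1:] * q = pCons 0 q + smult (- z) q" by simp
  then have "poly_row ([:- z, 1:] * q) M v = poly_row q M v v* M + (- z) *s poly_row q M v"
    by (simp only: poly_row_add poly_row_smult poly_row_pCons) simp
  then show ?thesis by (simp add: vec_eq_iff)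
qed

text \<open>\<open>M - c\<close> commutes with every polynomial in \<open>M\<close>.\<close>

lemma poly_row_diff_smult:
  "poly_row q M (v v* M - c *s v) = poly_row q M v v* M - c *s poly_row q M v"
proof (induction q)
  case (pCons a q)
  have "poly_row (pCons a q) M (v v* M - c *s v)
      = a *s (v v* M) - c *s (a *s v) + (poly_row q M v v* M v* M - c *s (poly_row q M v v* M))"
    unfolding poly_row_pCons pCons(2)
    by (simp add: vector_ssub_ldistrib vector_smult_assoc mult.commute vector_matrix_mult_diff_distrib
        scalar_vector_matrix_assoc)
  then show ?case
    by (simp add: algebra_simps scalar_vector_matrix_assoc vector_add_ldistrib)
qed simp

text \<open>One more iterate of \<open>v\<close> than the real dimension cannot be independent.
  Dependence is a notion for sets, so coinciding iterates are treated separately.\<close>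

lemma ex_poly_row_eq_0:
  fixes M :: "complex^'n^'n"
  shows "\<exists>p. p \<noteq> 0 \<and> poly_row p M v = 0"
proof -
  define g where "g k = ((\<lambda>w. w v* M) ^^ k) v" for k
  let ?N = "{..DIM(complex^'n)}"
  show ?thesis
  proof (cases "inj_on g ?N")
    case True
    have "dependent (g ` ?N)"
      by (rule dependent_biggerset) (use card_image[OF True] in simp)
    then obtain u where u: "\<exists>w\<in>g ` ?N. u w \<noteq> 0" "(\<Sum>w\<in>g ` ?N. u w *\<^sub>R w) = 0"
      by (auto simp: dependent_finite)
    let ?p = "\<Sum>k\<in>?N. monom (complex_of_real (u (g k))) k"
    from u(1) obtain k where k: "k \<in> ?N" "u (g k) \<noteq> 0" by auto
    have "coeff ?p k = complex_of_real (u (g k))"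
      using k by (simp add: coeff_sum coeff_monom)
    then have "?p \<noteq> 0" using k by (metis coeff_0 of_real_eq_0_iff)
    moreover have "complex_of_real a *s w = a *\<^sub>R w" for a and w :: "complex^'n"
      by (simp add: vec_eq_iff scaleR_conv_of_real[where 'a=complex])
    then have "poly_row ?p M v = (\<Sum>k\<in>?N. u (g k) *\<^sub>R g k)"
      unfolding poly_row_sum poly_row_monom g_def[symmetric] by simp
    moreover have "\<dots> = 0"
      using u(2) unfolding sum.reindex[OF True] by simp
    ultimately show ?thesis by metis
  next
    case False
    then obtain i j where ij: "i \<noteq> j" "g i = g j" by (auto simp: inj_on_def)
    have "coeff (monom (1::complex) i + monom (- 1) j) i = 1"
      using ij by (simp add: coeff_monom)
    moreover have "poly_row (monom 1 i + monom (- 1) j) M v = 0"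
      unfolding poly_row_add poly_row_monom g_def[symmetric] by (simp add: ij vec_eq_iff)
    ultimately show ?thesis by (metis coeff_0 zero_neq_one)
  qed
qed

section \<open>Left eigenvectors of a matrix and of its exponential\<close>

text \<open>Eigenvalues are defined by right eigenvectors. If \<open>z\<close> were not one,
  \<open>M - mat z\<close> would be injective, hence invertible, and could not annihilate the
  nonzero row \<open>w\<close>.\<close>

lemma matrix_eigenvalue_left:
  fixes M :: "complex^'n^'n"
  assumes "w v* M = z *s w" "w \<noteq> 0"
  shows "matrix_eigenvalue M z"
proof (rule ccontr)
  assume "\<not> matrix_eigenvalue M z"
  moreover have "mat z *v x = z *s x" for x :: "complex^'n"
    by (simp add: vec_eq_iff matrix_vector_mult_def mat_def if_distrib if_distribR cong: if_cong)
  ultimately have "\<forall>x. (M - mat z) *v x = 0 \<longrightarrow> x = 0"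
    by (auto simp: matrix_eigenvalue_def matrix_vector_mult_diff_rdistrib)
  then obtain B where "B ** (M - mat z) = mat 1"
    using matrix_left_invertible_ker by blast
  then have B: "(M - mat z) ** B = mat 1"
    by (simp add: matrix_left_right_inverse)
  have "w v* (M - mat z) = 0"
    using assms(1) by (simp add: vector_matrix_mult_diff_rdistrib)
      (simp add: vec_eq_iff vector_matrix_mult_def mat_def if_distrib if_distribR mult.commute cong: if_cong)
  then have "w v* mat 1 = 0"
    by (simp add: B[symmetric] vector_matrix_mul_assoc[symmetric] del: vector_matrix_mul_rid)
  with assms(2) show False by simp
qed

text \<open>The series is that of \<open>v\<close> times the exponential of \<open>M\<close>; writing it out avoids an exponential
  of complex matrices.\<close>

definition row_exp_eigen :: "complex^'n^'n \<Rightarrow> complex \<Rightarrow> complex^'n \<Rightarrow> bool" where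
  "row_exp_eigen M \<mu> v \<longleftrightarrow> (\<lambda>k. ((\<lambda>w. w v* M) ^^ k) v /\<^sub>R fact k) sums (exp \<mu> *s v)"

lemma bounded_linear_smult_vec: "bounded_linear (\<lambda>v::complex^'n. c *s v)"
  by (rule linear_linear[THEN iffD2]) (auto intro!: linearI simp: vec_eq_iff algebra_simps)

lemma bounded_linear_row: "bounded_linear (\<lambda>v::complex^'n. v v* (M :: complex^'m^'n))"
  by (rule linear_linear[THEN iffD2]) (auto intro!: linearI simp: algebra_simps,
      simp add: vec_eq_iff vector_matrix_mult_def scaleR_sum_right)

lemma row_power_add: "((\<lambda>w. w v* M) ^^ k) (v + u) = ((\<lambda>w. w v* M) ^^ k) v + ((\<lambda>w. w v* M) ^^ k) u"
  for M :: "complex^'n^'n"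
  by (induction k) (simp_all add: algebra_simps)

lemma row_power_smult:
  "((\<lambda>w. w v* M) ^^ k) (c *s v) = c *s ((\<lambda>w. w v* M) ^^ k) v"
  for M :: "complex^'n^'n"
  by (induction k) (simp_all add: scalar_vector_matrix_assoc)

lemma row_exp_eigen_add:
  "row_exp_eigen M \<mu> v \<Longrightarrow> row_exp_eigen M \<mu> u \<Longrightarrow> row_exp_eigen M \<mu> (v + u)"
  unfolding row_exp_eigen_def row_power_add scaleR_right_distrib vector_add_ldistrib
  by (rule sums_add)

lemma row_exp_eigen_smult: "row_exp_eigen M \<mu> v \<Longrightarrow> row_exp_eigen M \<mu> (c *s v)"
  unfolding row_exp_eigen_def row_power_smult
  by (drule bounded_linear.sums[OF bounded_linear_smult_vec[of c]])
    (simp add: vector_smult_assoc mult.commute linear_scale[OF bounded_linear.linear, OF bounded_linear_smult_vec])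

text \<open>\<open>M\<close> commutes with its exponential, so the left eigenspaces of the
  exponential are invariant under \<open>M\<close>.\<close>

lemma row_exp_eigen_row: "row_exp_eigen M \<mu> v \<Longrightarrow> row_exp_eigen M \<mu> (v v* M)"
  unfolding row_exp_eigen_def funpow_swap1[of "\<lambda>w. w v* M", symmetric]
  by (drule bounded_linear.sums[OF bounded_linear_row[of M]])
    (simp add: scalar_vector_matrix_assoc linear_scale[OF bounded_linear.linear, OF bounded_linear_row])

lemma row_exp_eigen_poly_row: "row_exp_eigen M \<mu> v \<Longrightarrow> row_exp_eigen M \<mu> (poly_row q M v)"
proof (induction q)
  case 0
  then show ?case using row_exp_eigen_smult[of M \<mu> v 0] by simp
next
  case (pCons a q)
  then show ?case by (simp add: row_exp_eigen_add row_exp_eigen_smult row_exp_eigen_row)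
qed

lemma row_exp_eigen_diff:
  assumes "row_exp_eigen M \<mu> v"
  shows "row_exp_eigen M \<mu> (v v* M - c *s v)"
  using row_exp_eigen_add[OF row_exp_eigen_row[OF assms] row_exp_eigen_smult[OF assms, of "- c"]]
  by simp

lemma exp_sums: "(\<lambda>k. z ^ k / fact k) sums exp (z::'a::{real_normed_field,banach})"
  using exp_converges[of z] by (simp add: scaleR_conv_of_real divide_inverse mult.commute)

text \<open>The exponential series differentiated termwise; the factor \<open>of_nat k\<close> makes
  the truncated exponent at \<open>k = 0\<close> harmless.\<close>

lemma sums_derivative_exp: "(\<lambda>k. of_nat k * z ^ (k - 1) / fact k) sums exp (z::'a::{real_normed_field,banach})"
proof -
  have "of_nat (Suc k) * z ^ k / fact (Suc k) = z ^ k / fact k" for k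
    by (simp add: field_simps del: of_nat_Suc)
  then have "(\<lambda>k. of_nat (Suc k) * z ^ (Suc k - 1) / fact (Suc k)) sums exp z"
    using exp_sums[of z] by simp
  then show ?thesis by (subst (asm) sums_Suc_iff) simp
qed

lemma row_exp_eigen_eigenvector:
  assumes "v v* M = z *s v" "row_exp_eigen M \<mu> v" "v \<noteq> 0"
  shows "exp z = exp \<mu>"
proof -
  from assms(3) obtain i where i: "v $ i \<noteq> 0" by (auto simp: vec_eq_iff)
  have "((\<lambda>w. w v* M) ^^ k) v = z ^ k *s v" for k
    by (induction k) (simp_all add: scalar_vector_matrix_assoc assms(1) vector_smult_assoc mult.commute)
  with assms(2) have "(\<lambda>k. z ^ k * v $ i /\<^sub>R fact k) sums (exp \<mu> * v $ i)"
    by (simp add: row_exp_eigen_def vec_sums_iff)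
  moreover have "(\<lambda>k. z ^ k * v $ i /\<^sub>R fact k) sums (exp z * v $ i)"
    using sums_mult2[OF exp_sums[of z], of "v $ i"]
    by (simp add: scaleR_conv_of_real divide_inverse mult_ac)
  ultimately show ?thesis
    using i sums_unique2 by (metis mult_right_cancel)
qed

text \<open>On such a Jordan chain the exponential sends \<open>v\<close> to
  \<open>exp \<mu>\<close> times \<open>v + u\<close>, but by assumption to \<open>exp \<mu>\<close>
  times \<open>v\<close>, and \<open>exp \<mu>\<close> is nonzero.\<close>

lemma row_exp_eigen_jordan:
  assumes "v v* M = \<mu> *s v + u" "u v* M = \<mu> *s u" "row_exp_eigen M \<mu> v"
  shows "u = 0"
proof -
  have p: "((\<lambda>w. w v* M) ^^ k) v = \<mu> ^ k *s v + (of_nat k * \<mu> ^ (k - 1)) *s u" for k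
  proof (induction k)
    case (Suc k)
    then show ?case
      by (cases k) (simp_all add: assms(1,2) vector_matrix_left_distrib
          scalar_vector_matrix_assoc, simp_all add: vec_eq_iff algebra_simps)
  qed simp
  have "u $ i = 0" for i
  proof -
    have "(\<lambda>k. (\<mu> ^ k * v $ i + of_nat k * \<mu> ^ (k - 1) * u $ i) /\<^sub>R fact k) sums (exp \<mu> * v $ i)"
      using assms(3) by (simp add: row_exp_eigen_def vec_sums_iff p)
    moreover have "(\<lambda>k. (\<mu> ^ k * v $ i + of_nat k * \<mu> ^ (k - 1) * u $ i) /\<^sub>R fact k)
        sums (exp \<mu> * v $ i + exp \<mu> * u $ i)"
      using sums_add[OF sums_mult2[OF exp_sums[of \<mu>], of "v $ i"]
          sums_mult2[OF sums_derivative_exp[of \<mu>], of "u $ i"]]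
      by (simp add: scaleR_conv_of_real divide_inverse algebra_simps)
    ultimately show ?thesis
      using sums_unique2 by (simp add: sums_iff)
  qed
  then show ?thesis by (simp add: vec_eq_iff)
qed

text \<open>Two logarithms differ by an integer multiple of \<open>2 * pi * \<i>\<close>. As
  \<open>\<mu>\<close> is real, that multiple is the whole imaginary part of \<open>z\<close>, and
  the strip leaves only zero.\<close>

lemma exp_eq_exp_strip:
  assumes "exp z = exp (complex_of_real \<mu>)" "\<bar>Im z\<bar> < pi"
  shows "z = of_real \<mu>"
proof -
  obtain n :: int where n: "z = of_real \<mu> + (of_int (2 * n) * pi) * \<i>"
    using assms(1) by (auto simp: exp_eq)
  have "\<bar>of_int (2 * n) * pi\<bar> < 1 * pi" using assms(2) n by simp
  then have "\<bar>real_of_int (2 * n)\<bar> < 1"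
    by (simp add: abs_mult)
  then have "n = 0" by linarith
  then show ?thesis using n by simp
qed

text \<open>Peel off one linear factor of an annihilating polynomial at a time: a factor whose root is
  an eigenvalue has root \<open>\<mu>\<close> by the strip condition, and a Jordan block of size two is
  excluded by \<open>row_exp_eigen_jordan\<close>.\<close>

lemma row_exp_eigen_imp_eigenvector:
  fixes M :: "complex^'n^'n"
  assumes strip: "\<And>z. matrix_eigenvalue M z \<Longrightarrow> \<bar>Im z\<bar> < pi"
    and v: "row_exp_eigen M (complex_of_real \<mu>) v"
  shows "v v* M = complex_of_real \<mu> *s v"
proof -
  obtain p where p: "p \<noteq> 0" "poly_row p M v = 0"
    using ex_poly_row_eq_0 by blast
  show ?thesis
    using p v
  proof (induction "degree p" arbitrary: p v)
    case 0
    then obtain a where "p = [:a:]" "a \<noteq> 0"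
      by (metis degree_eq_zeroE pCons_0_0)
    with 0 show ?case by auto
  next
    case (Suc d)
    obtain z where "poly p z = 0"
      using Suc.hyps(2) fundamental_theorem_of_algebra[of p] by (auto simp: constant_degree)
    then obtain q where q: "p = [:- z, 1:] * q"
      by (auto simp: poly_eq_0_iff_dvd)
    with Suc.prems have q0: "q \<noteq> 0" by auto
    have dq: "d = degree q"
      using Suc.hyps(2) q0 unfolding q by (subst (asm) degree_mult_eq) auto
    let ?w = "poly_row q M v" and ?u = "v v* M - complex_of_real \<mu> *s v"
    have w: "?w v* M = z *s ?w"
      using Suc.prems(2) unfolding q poly_row_linear_factor by simp
    show ?case
    proof (cases "?w = 0")
      case True
      with Suc.hyps(1)[OF dq q0 True] Suc.prems show ?thesis by blast
    next
      case False
      have "exp z = exp (complex_of_real \<mu>)"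
        using row_exp_eigen_eigenvector[OF w row_exp_eigen_poly_row[OF Suc.prems(3)] False] .
      then have "z = of_real \<mu>"
        using exp_eq_exp_strip strip[OF matrix_eigenvalue_left[OF w False]] by blast
      \<comment> \<open>The induction hypothesis for \<open>q\<close> goes to \<open>?u\<close>
        rather than to \<open>v\<close>: \<open>?u\<close> stays in the eigenspace of the
        exponential, and moving \<open>q(M)\<close> past \<open>M - \<mu>\<close> shows that
        \<open>q\<close> annihilates it.\<close>
      with w have "poly_row q M ?u = 0"
        by (simp add: poly_row_diff_smult)
      then have "?u v* M = complex_of_real \<mu> *s ?u"
        using Suc.hyps(1)[OF dq q0] row_exp_eigen_diff[OF Suc.prems(3)] by blast
      then have "?u = 0"
        using row_exp_eigen_jordan[of v M "of_real \<mu>" ?u] Suc.prems(3) by simp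
      then show ?thesis by simp
    qed
  qed
qed

section \<open>Rows of a principal logarithm\<close>

text \<open>Powers are built by multiplying on the left, whereas iterated rows are multiplied on the
  right.\<close>

lemma matrix_power_commute:
  fixes A :: "'a::semiring_1^'n^'n"
  shows "(((**) A) ^^ k) (mat 1) ** A = A ** (((**) A) ^^ k) (mat 1)"
  by (induction k) (simp_all add: matrix_mul_assoc[symmetric])

lemma row_of_principal_log:
  fixes L :: "real^'n^'n"
  assumes "is_principal_log A L" and A: "\<And>j. A $ i $ j = (if j = i then exp \<mu> else 0)"
  shows "L $ i $ j = (if j = i then \<mu> else 0)"
proof -
  let ?M = "complex_matrix L" and ?v = "axis i 1 :: complex^'n"
  \<comment> \<open>Iterating the unit row through \<open>?M\<close> reads off row \<open>i\<close>
    of the powers of \<open>L\<close>, which turns the real exponential series into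
    \<open>row_exp_eigen\<close>.\<close>
  have pw: "((\<lambda>w. w v* ?M) ^^ k) ?v = (\<chi> j. complex_of_real (((((**) L) ^^ k) (mat 1)) $ i $ j))" for k
  proof (induction k)
    case 0
    then show ?case by (simp add: vec_eq_iff mat_def axis_def)
  next
    case (Suc k)
    have "((((**) L) ^^ Suc k) (mat 1)) = (((**) L) ^^ k) (mat 1) ** L"
      by (simp add: matrix_power_commute)
    then show ?case
      unfolding funpow.simps comp_apply Suc
      by (simp add: vec_eq_iff vector_matrix_mult_def complex_matrix_def matrix_matrix_mult_def)
  qed
  have "\<forall>j. (\<lambda>k. ((((**) L) ^^ k) (mat 1)) $ i $ j / fact k) sums (A $ i $ j)"
    using assms(1) by (simp add: is_principal_log_def matrix_exp_sums_iff)
  then have "(\<lambda>k. complex_of_real (((((**) L) ^^ k) (mat 1)) $ i $ j / fact k)) sums of_real (A $ i $ j)" for j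
    by (simp add: sums_of_real_iff del: of_real_divide)
  then have "row_exp_eigen ?M (complex_of_real \<mu>) ?v"
    unfolding row_exp_eigen_def vec_sums_iff pw
    by (simp add: A axis_def scaleR_conv_of_real[where 'a=complex] divide_inverse mult.commute exp_of_real
        if_distrib cong: if_cong)
  then have "?v v* ?M = complex_of_real \<mu> *s ?v"
    using assms(1) by (intro row_exp_eigen_imp_eigenvector) (auto simp: is_principal_log_def)
  then have "(?v v* ?M) $ j = (complex_of_real \<mu> *s ?v) $ j" by simp
  then show ?thesis
    by (auto simp: vector_matrix_mult_def axis_def complex_matrix_def if_distrib if_distribR
        cong: if_cong split: if_splits)
qed


section \<open>Explicit exponential on the Lie algebra of \<open>H_group\<close>\<close>

text \<open>One parametrization serves both \<open>H_group\<close>, where the diagonal is positive,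
  and its Lie algebra, where it is arbitrary.\<close>

definition lowmat :: "real \<Rightarrow> real \<Rightarrow> real \<Rightarrow> real \<Rightarrow> real \<Rightarrow> real^3^3" where
  "lowmat p q r u w = vector [vector [p, 0, 0], vector [0, q, 0], vector [r, u, w]]"

lemma lowmat_nth [simp]:
  "lowmat p q r u w $ 1 $ 1 = p" "lowmat p q r u w $ 1 $ 2 = 0" "lowmat p q r u w $ 1 $ 3 = 0"
  "lowmat p q r u w $ 2 $ 1 = 0" "lowmat p q r u w $ 2 $ 2 = q" "lowmat p q r u w $ 2 $ 3 = 0"
  "lowmat p q r u w $ 3 $ 1 = r" "lowmat p q r u w $ 3 $ 2 = u" "lowmat p q r u w $ 3 $ 3 = w"
  by (simp_all add: lowmat_def)

lemma eq_lowmat_iff: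
  "A = lowmat p q r u w \<longleftrightarrow> A $ 1 $ 1 = p \<and> A $ 1 $ 2 = 0 \<and> A $ 1 $ 3 = 0 \<and> A $ 2 $ 1 = 0 \<and>
     A $ 2 $ 2 = q \<and> A $ 2 $ 3 = 0 \<and> A $ 3 $ 1 = r \<and> A $ 3 $ 2 = u \<and> A $ 3 $ 3 = w"
  by (auto simp: vec_eq_iff forall_3)

lemma lowmat_eq_iff [simp]:
  "lowmat p q r u w = lowmat p' q' r' u' w' \<longleftrightarrow> p = p' \<and> q = q' \<and> r = r' \<and> u = u' \<and> w = w'"
  by (auto simp: eq_lowmat_iff)

lemma lowmat_mult:
  "lowmat p q r u w ** lowmat p' q' r' u' w' =
     lowmat (p * p') (q * q') (r * p' + w * r') (u * q' + w * u') (w * w')"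
  by (simp add: eq_lowmat_iff matrix_matrix_mult_def sum_3)

lemma lowmat_scaleR:
  "t *\<^sub>R lowmat p q r u w = lowmat (t * p) (t * q) (t * r) (t * u) (t * w)"
  by (simp add: eq_lowmat_iff)

lemma mat_1_eq_lowmat: "mat 1 = lowmat 1 1 0 0 1"
  by (simp add: eq_lowmat_iff mat_def)

lemma H_group_iff: "T \<in> H_group \<longleftrightarrow> (\<exists>a b c d e. T = lowmat a b c d e \<and> 0 < a \<and> 0 < b \<and> 0 < e)"
  by (auto simp: H_group_def eq_lowmat_iff)

text \<open>Divided differences: the off-diagonal entries of the powers and of the exponential of a
  triangular block with diagonal \<open>(p, w)\<close> and off-diagonal entry \<open>1\<close>.\<close>

definition pow_dd :: "real \<Rightarrow> real \<Rightarrow> nat \<Rightarrow> real" where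
  "pow_dd p w k = (if p = w then real k * p ^ (k - 1) else (p ^ k - w ^ k) / (p - w))"

definition exp_dd :: "real \<Rightarrow> real \<Rightarrow> real" where
  "exp_dd p w = (if p = w then exp p else (exp p - exp w) / (p - w))"

text \<open>Off-diagonal entry of the triangular block times its \<open>k\<close>-th power.\<close>

lemma pow_dd_Suc: "pow_dd p w (Suc k) = p ^ k + w * pow_dd p w k"
proof (cases "p = w")
  case True
  then show ?thesis by (cases k) (simp_all add: pow_dd_def algebra_simps)
next
  case False
  then show ?thesis by (simp add: pow_dd_def field_simps)
qed

lemma pow_dd_sums_exp_dd: "(\<lambda>k. pow_dd p w k / fact k) sums exp_dd p w"
proof (cases "p = w")
  case True
  then show ?thesis using sums_derivative_exp[of p] by (simp add: pow_dd_def exp_dd_def)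
next
  case False
  have "(\<lambda>k. (p ^ k / fact k - w ^ k / fact k) / (p - w)) sums ((exp p - exp w) / (p - w))"
    by (intro sums_divide sums_diff exp_sums)
  with False show ?thesis
    by (simp add: pow_dd_def exp_dd_def diff_divide_distrib mult.commute)
qed

text \<open>Strict monotonicity of \<open>exp\<close>. Positivity permits division by
  \<open>exp_dd\<close>, both to recover a logarithm and to construct one.\<close>

lemma exp_dd_pos: "exp_dd p w > 0"
  by (cases p w rule: linorder_cases) (auto simp: exp_dd_def divide_neg_neg)

text \<open>The factor \<open>t\<close> cancels against the denominator
  \<open>t * p - t * w\<close>, which leaves a formula that also covers
  \<open>t = 0\<close>.\<close>

lemma mult_exp_dd_scale:
  "t * exp_dd (t * p) (t * w) = (if p = w then t * exp (t * p) else (exp (t * p) - exp (t * w)) / (p - w))"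
  by (cases "t = 0") (auto simp: exp_dd_def field_simps)

text \<open>Off-diagonal entry of \<open>exp (a N) exp (b N) = exp ((a + b) N)\<close> for the
  triangular block \<open>N\<close> with diagonal \<open>(p, w)\<close>.\<close>

lemma exp_dd_add:
  "a * exp_dd (a * p) (a * w) * exp (b * p) + exp (a * w) * (b * exp_dd (b * p) (b * w))
     = (a + b) * exp_dd ((a + b) * p) ((a + b) * w)"
  unfolding mult_exp_dd_scale unfolding distrib_right exp_add
  by (cases "p = w") (simp_all add: diff_divide_distrib algebra_simps)

lemma lowmat_power:
  "(((**) (lowmat p q r u w)) ^^ k) (mat 1) =
     lowmat (p ^ k) (q ^ k) (r * pow_dd p w k) (u * pow_dd q w k) (w ^ k)"
proof (induction k)
  case 0
  then show ?case by (simp add: mat_1_eq_lowmat pow_dd_def)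
next
  case (Suc k)
  then show ?case by (simp add: lowmat_mult pow_dd_Suc algebra_simps)
qed

lemma matrix_exp_lowmat:
  "matrix_exp (lowmat p q r u w) =
     lowmat (exp p) (exp q) (r * exp_dd p w) (u * exp_dd q w) (exp w)"
proof -
  have "(\<lambda>k. c * pow_dd p w k / fact k) sums (c * exp_dd p w)" for c p w
    using sums_mult[OF pow_dd_sums_exp_dd[of p w], of c] by simp
  then show ?thesis
    by (simp add: matrix_exp_sums_iff lowmat_power forall_3 exp_sums)
qed

section \<open>Principal logarithm and real powers on \<open>H_group\<close>\<close>

text \<open>Once its first two rows are known, \<open>L\<close> lies in the Lie algebra. There the
  explicit exponential is injective, because the real \<open>exp\<close> is and the divided
  differences do not vanish.\<close>

lemma is_principal_log_lowmat:
  assumes "is_principal_log (matrix_exp (lowmat p q r u w)) L"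
  shows "L = lowmat p q r u w"
proof -
  have "L $ 1 $ j = (if j = 1 then p else 0)" for j
  proof (rule row_of_principal_log[OF assms])
    show "matrix_exp (lowmat p q r u w) $ 1 $ j = (if j = 1 then exp p else 0)" for j
      using exhaust_3[of j] by (auto simp: matrix_exp_lowmat)
  qed
  moreover have "L $ 2 $ j = (if j = 2 then q else 0)" for j
  proof (rule row_of_principal_log[OF assms])
    show "matrix_exp (lowmat p q r u w) $ 2 $ j = (if j = 2 then exp q else 0)" for j
      using exhaust_3[of j] by (auto simp: matrix_exp_lowmat)
  qed
  ultimately have L: "L = lowmat p q (L $ 3 $ 1) (L $ 3 $ 2) (L $ 3 $ 3)"
    by (simp add: eq_lowmat_iff)
  have "matrix_exp L = matrix_exp (lowmat p q r u w)"
    using assms by (simp add: is_principal_log_def)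
  then show ?thesis
    using exp_dd_pos[of p w] exp_dd_pos[of q w]
    by (subst (asm) L) (subst L, auto simp: matrix_exp_lowmat)
qed

lemma matrix_log_exp_lowmat: "matrix_log (matrix_exp (lowmat p q r u w)) = lowmat p q r u w"
proof -
  \<comment> \<open>The eigenvalues of a triangular matrix are among its diagonal entries, which are
    real, so the strip condition holds.\<close>
  have "Im z = 0" if ev: "matrix_eigenvalue (complex_matrix (lowmat p q r u w)) z" for z
  proof -
    from ev obtain v where v: "v \<noteq> 0" "complex_matrix (lowmat p q r u w) *v v = z *s v"
      by (auto simp: matrix_eigenvalue_def)
    from v(2) have "of_real p * v $ 1 = z * v $ 1" "of_real q * v $ 2 = z * v $ 2"
        "of_real r * v $ 1 + of_real u * v $ 2 + of_real w * v $ 3 = z * v $ 3"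
      by (simp_all add: vec_eq_iff forall_3 matrix_vector_mult_def complex_matrix_def sum_3)
    with v(1) have "z = of_real p \<or> z = of_real q \<or> z = of_real w"
      by (auto simp: vec_eq_iff forall_3)
    then show ?thesis by auto
  qed
  then have "is_principal_log (matrix_exp (lowmat p q r u w)) (lowmat p q r u w)"
    by (simp add: is_principal_log_def)
  then show ?thesis
    unfolding matrix_log_def using is_principal_log_lowmat by (rule the_equality)
qed

lemma matrix_rpow_exp_lowmat:
  "matrix_rpow (matrix_exp (lowmat p q r u w)) t = matrix_exp (lowmat (t * p) (t * q) (t * r) (t * u) (t * w))"
  by (simp add: matrix_rpow_def matrix_log_exp_lowmat lowmat_scaleR)

lemma H_group_eq_exp:
  assumes "T \<in> H_group"
  obtains p q r u w where "T = matrix_exp (lowmat p q r u w)"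
proof -
  from assms obtain a b c d e where T: "T = lowmat a b c d e" "0 < a" "0 < b" "0 < e"
    by (auto simp: H_group_iff)
  \<comment> \<open>The argument solves \<open>matrix_exp_lowmat\<close> entry by entry.\<close>
  have "T = matrix_exp (lowmat (ln a) (ln b) (c / exp_dd (ln a) (ln e)) (d / exp_dd (ln b) (ln e)) (ln e))"
    using T exp_dd_pos[of "ln a" "ln e"] exp_dd_pos[of "ln b" "ln e"]
    by (simp add: matrix_exp_lowmat)
  then show ?thesis by (rule that)
qed

lemma matrix_rpow_in_H_group: "T \<in> H_group \<Longrightarrow> matrix_rpow T t \<in> H_group"
  by (erule H_group_eq_exp, simp only: matrix_rpow_exp_lowmat) (simp add: matrix_exp_lowmat H_group_iff)

lemma matrix_rpow_add:
  assumes "T \<in> H_group"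
  shows "matrix_rpow T a ** matrix_rpow T b = matrix_rpow T (a + b)"
proof -
  obtain p q r u w where T: "T = matrix_exp (lowmat p q r u w)"
    using H_group_eq_exp[OF assms] .
  \<comment> \<open>Stated for arbitrary \<open>r\<close> and \<open>p\<close>, so that it also
    serves the entry with \<open>u\<close> and \<open>q\<close>.\<close>
  have "a * r * exp_dd (a * p) (a * w) * exp (b * p) + exp (a * w) * (b * r * exp_dd (b * p) (b * w))
      = (a + b) * r * exp_dd ((a + b) * p) ((a + b) * w)" for r p
    using arg_cong[OF exp_dd_add[of a p w b], of "(*) r"] by (simp add: algebra_simps)
  then show ?thesis
    unfolding T matrix_rpow_exp_lowmat unfolding matrix_exp_lowmat lowmat_mult lowmat_eq_iff
    by (simp only: exp_add distrib_right)
qed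

lemma matrix_rpow_rpow:
  assumes "T \<in> H_group"
  shows "matrix_rpow (matrix_rpow T a) b = matrix_rpow T (a * b)"
  using assms by (elim H_group_eq_exp) (simp only: matrix_rpow_exp_lowmat mult_ac)

lemma matrix_rpow_0: "T \<in> H_group \<Longrightarrow> matrix_rpow T 0 = mat 1"
  by (erule H_group_eq_exp, simp only: matrix_rpow_exp_lowmat)
    (simp add: matrix_exp_lowmat mat_1_eq_lowmat)

lemma matrix_rpow_1: "T \<in> H_group \<Longrightarrow> matrix_rpow T 1 = T"
  by (erule H_group_eq_exp) (simp only: matrix_rpow_exp_lowmat mult_1)

section \<open>Group structure and Cholesky factors\<close>

lemma H_group_mult: "S \<in> H_group \<Longrightarrow> T \<in> H_group \<Longrightarrow> S ** T \<in> H_group"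
  by (force simp: H_group_iff lowmat_mult)

lemma H_group_inverse:
  assumes "T \<in> H_group"
  obtains S where "S \<in> H_group" "S ** T = mat 1" "T ** S = mat 1"
proof -
  from assms obtain a b c d e where T: "T = lowmat a b c d e" "0 < a" "0 < b" "0 < e"
    by (auto simp: H_group_iff)
  show ?thesis
  proof
    let ?S = "lowmat (1 / a) (1 / b) (- c / (a * e)) (- d / (b * e)) (1 / e)"
    show "?S \<in> H_group" using T by (force simp: H_group_iff)
    show "?S ** T = mat 1" using T by (simp add: lowmat_mult mat_1_eq_lowmat)
    then show "T ** ?S = mat 1" by (simp add: matrix_left_right_inverse)
  qed
qed

lemma matrix_inv_mult_H_group:
  assumes "T \<in> H_group"
  shows "matrix_inv T ** (T ** S) = S" "T ** (matrix_inv T ** S) = S" "matrix_inv T \<in> H_group"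
proof -
  obtain R where R: "R \<in> H_group" "R ** T = mat 1" "T ** R = mat 1"
    using H_group_inverse[OF assms] .
  \<comment> \<open>\<open>matrix_inv\<close> is a Hilbert choice, so its properties need an actual
    inverse, here \<open>R\<close>.\<close>
  then have "T ** matrix_inv T = mat 1 \<and> matrix_inv T ** T = mat 1"
    unfolding matrix_inv_def
    by (intro someI[of "\<lambda>S. T ** S = mat 1 \<and> S ** T = mat 1" R] conjI)
  then have "matrix_inv T ** T = mat 1" "T ** matrix_inv T = mat 1" by simp_all
  then show "matrix_inv T ** (T ** S) = S" "T ** (matrix_inv T ** S) = S"
    by (simp_all add: matrix_mul_assoc)
  have "matrix_inv T = (R ** T) ** matrix_inv T" using R by simp
  also have "\<dots> = R" using \<open>T ** matrix_inv T = mat 1\<close> by (simp flip: matrix_mul_assoc)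
  finally show "matrix_inv T \<in> H_group" using R by simp
qed

lemma Phi_lowmat_nth:
  "Phi (lowmat a b c d e) $ 1 $ 1 = a\<^sup>2" "Phi (lowmat a b c d e) $ 1 $ 2 = 0" "Phi (lowmat a b c d e) $ 1 $ 3 = a * c"
  "Phi (lowmat a b c d e) $ 2 $ 1 = 0" "Phi (lowmat a b c d e) $ 2 $ 2 = b\<^sup>2" "Phi (lowmat a b c d e) $ 2 $ 3 = b * d"
  "Phi (lowmat a b c d e) $ 3 $ 1 = a * c" "Phi (lowmat a b c d e) $ 3 $ 2 = b * d"
  "Phi (lowmat a b c d e) $ 3 $ 3 = c\<^sup>2 + d\<^sup>2 + e\<^sup>2"
  by (simp_all add: Phi_def matrix_matrix_mult_def transpose_def sum_3 power2_eq_square)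

text \<open>The positive \<open>a\<close> and \<open>b\<close> are determined by their squares, then
  \<open>c\<close> and \<open>d\<close> by the mixed entries, and \<open>e\<close> by the last
  diagonal entry.\<close>

lemma inj_on_Phi: "inj_on Phi H_group"
proof (rule inj_onI)
  fix S T assume "S \<in> H_group" "T \<in> H_group" and eq: "Phi S = Phi T"
  then obtain a b c d e a' b' c' d' e'
    where S: "S = lowmat a b c d e" "0 < a" "0 < b" "0 < e"
      and T: "T = lowmat a' b' c' d' e'" "0 < a'" "0 < b'" "0 < e'"
    by (auto simp: H_group_iff)
  have "a\<^sup>2 = a'\<^sup>2" "b\<^sup>2 = b'\<^sup>2" "a * c = a' * c'" "b * d = b' * d'" "c\<^sup>2 + d\<^sup>2 + e\<^sup>2 = c'\<^sup>2 + d'\<^sup>2 + e'\<^sup>2"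
    using eq unfolding S T by (metis Phi_lowmat_nth)+
  then show "S = T"
    using S T by (auto simp: power2_eq_iff)
qed

lemma Omega_subset_Phi_image:
  assumes "x \<in> Omega"
  shows "x \<in> Phi ` H_group"
proof -
  define a b c d e where "a = x $ 1 $ 1" "b = x $ 2 $ 2" "c = x $ 3 $ 1" "d = x $ 3 $ 2" "e = x $ 3 $ 3"
  note defs = a_b_c_d_e_def
  have zero: "x $ 1 $ 2 = 0" "x $ 2 $ 1 = 0"
    using assms by (auto simp: Omega_def V_space_def)
  have tr: "transpose x = x" and pos: "\<And>v. v \<noteq> 0 \<Longrightarrow> 0 < v \<bullet> (x *v v)"
    using assms by (auto simp: Omega_def pos_def_matrix_def)
  have sym: "x $ 1 $ 3 = c" "x $ 2 $ 3 = d"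
    using tr by (auto simp: transpose_def vec_eq_iff defs)
  have quad: "0 < a * v1\<^sup>2 + b * v2\<^sup>2 + e * v3\<^sup>2 + 2 * c * v1 * v3 + 2 * d * v2 * v3"
    if "v1 \<noteq> 0 \<or> v2 \<noteq> 0 \<or> v3 \<noteq> 0" for v1 v2 v3
    using pos[of "vector [v1, v2, v3]"] that
    by (simp add: vec_eq_iff forall_3 inner_vec_def matrix_vector_mult_def sum_3 zero sym
        defs[symmetric] power2_eq_square algebra_simps)
  have ab: "0 < a" "0 < b"
    using quad[of 1 0 0] quad[of 0 1 0] by auto
  \<comment> \<open>This test vector minimizes the quadratic form among vectors with third
    coordinate \<open>1\<close>; the minimum is the Schur complement, whose root becomes the last
    diagonal entry.\<close>
  have "0 < a * (- c / a)\<^sup>2 + b * (- d / b)\<^sup>2 + e - 2 * c * (c / a) - 2 * d * (d / b)"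
    using quad[of "- c / a" "- d / b" 1] by simp
  also have "\<dots> = e - c\<^sup>2 / a - d\<^sup>2 / b"
    using ab by (simp add: power2_eq_square)
  finally have e: "0 < e - c\<^sup>2 / a - d\<^sup>2 / b" .
  let ?T = "lowmat (sqrt a) (sqrt b) (c / sqrt a) (d / sqrt b) (sqrt (e - c\<^sup>2 / a - d\<^sup>2 / b))"
  have "Phi ?T = x"
    using ab e by (simp add: vec_eq_iff forall_3 Phi_lowmat_nth zero sym defs[symmetric] power_divide)
  moreover have "?T \<in> H_group"
    using ab e by (force simp: H_group_iff)
  ultimately show ?thesis by force
qed

text \<open>Injectivity of \<open>Phi\<close> identifies the factor, so that of a mean can be read
  off without first placing the mean in \<open>Omega\<close>.\<close>

lemma chol_Phi: "T \<in> H_group \<Longrightarrow> chol (Phi T) = T"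
  by (simp add: chol_def inj_on_Phi)

lemma chol_in_H_group: "x \<in> Omega \<Longrightarrow> chol x \<in> H_group"
  by (simp add: chol_def inv_into_into Omega_subset_Phi_image)

lemma Phi_chol: "x \<in> Omega \<Longrightarrow> Phi (chol x) = x"
  by (simp add: chol_def f_inv_into_f Omega_subset_Phi_image)

section \<open>Weighted means\<close>

lemma cv_wmean_0: "x \<in> Omega \<Longrightarrow> y \<in> Omega \<Longrightarrow> cv_wmean 0 x y = x"
  by (simp add: cv_wmean_def matrix_rpow_0 H_group_mult matrix_inv_mult_H_group chol_in_H_group Phi_chol)

lemma cv_wmean_1: "x \<in> Omega \<Longrightarrow> y \<in> Omega \<Longrightarrow> cv_wmean 1 x y = y"
  by (simp add: cv_wmean_def matrix_rpow_1 H_group_mult matrix_inv_mult_H_group chol_in_H_group Phi_chol)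

lemma cv_wmean_cv_wmean:
  assumes "x \<in> Omega" "y \<in> Omega"
  shows "cv_wmean l (cv_wmean s x y) (cv_wmean t x y) = cv_wmean ((1 - l) * s + l * t) x y"
proof -
  let ?X = "chol x" and ?Z = "matrix_inv (chol x) ** chol y"
  have X: "?X \<in> H_group" and Z: "?Z \<in> H_group"
    using assms by (simp_all add: chol_in_H_group H_group_mult matrix_inv_mult_H_group)
  have g: "?X ** matrix_rpow ?Z a \<in> H_group" for a
    using X Z by (simp add: H_group_mult matrix_rpow_in_H_group)
  have chol_mean: "chol (cv_wmean a x y) = ?X ** matrix_rpow ?Z a" for a
    by (simp add: cv_wmean_def chol_Phi g)
  have step: "?X ** matrix_rpow ?Z (a + b) = (?X ** matrix_rpow ?Z a) ** matrix_rpow ?Z b" for a b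
    by (simp add: matrix_rpow_add[OF Z] flip: matrix_mul_assoc)
  \<comment> \<open>The relative factor of the two means is again a power of \<open>?Z\<close>, so
    the outer power only multiplies exponents.\<close>
  have "matrix_inv (?X ** matrix_rpow ?Z s) ** (?X ** matrix_rpow ?Z t) = matrix_rpow ?Z (t - s)"
    using step[of s "t - s"] by (simp add: matrix_inv_mult_H_group(1)[OF g])
  then have "cv_wmean l (cv_wmean s x y) (cv_wmean t x y)
      = Phi ((?X ** matrix_rpow ?Z s) ** matrix_rpow ?Z ((t - s) * l))"
    by (simp add: cv_wmean_def[of l] chol_mean matrix_rpow_rpow[OF Z])
  also have "\<dots> = cv_wmean (s + (t - s) * l) x y"
    unfolding step[symmetric] cv_wmean_def ..
  also have "s + (t - s) * l = (1 - l) * s + l * t"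
    by (simp add: algebra_simps)
  finally show ?thesis .
qed

theorem proposition4p7:
  fixes x y :: "real^3^3"
  assumes "x \<in> Omega" and "y \<in> Omega"
  shows "(\<forall>s t l. 0 \<le> s \<and> s \<le> t \<and> t \<le> 1 \<and> 0 \<le> l \<and> l \<le> 1 \<longrightarrow>
           cv_wmean l (cv_wmean s x y) (cv_wmean t x y) = cv_wmean ((1 - l) * s + l * t) x y)
       \<and> (\<forall>s t. 0 \<le> s \<and> s \<le> t \<and> t \<le> 1 \<longrightarrow>
           cv_mean (cv_wmean s x y) (cv_wmean t x y) = cv_wmean ((s + t) / 2) x y)
       \<and> (\<forall>t. 0 \<le> t \<and> t \<le> 1/2 \<longrightarrow>
           cv_wmean t x y = cv_mean x (cv_wmean (2 * t) x y))
       \<and> (\<forall>t. 1/2 \<le> t \<and> t \<le> 1 \<longrightarrow>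
           cv_wmean t x y = cv_mean (cv_wmean (2 * t - 1) x y) y)"
proof -
  note mean = cv_wmean_cv_wmean[OF assms]
  have half: "cv_mean (cv_wmean s x y) (cv_wmean t x y) = cv_wmean ((s + t) / 2) x y" for s t
    using mean[of "1 / 2" s t] by (simp add: add_divide_distrib)
  \<comment> \<open>\<open>x\<close> is the mean of weight \<open>0\<close>, and below
    \<open>y\<close> that of weight \<open>1\<close>, so both claims are instances of
    \<open>half\<close>.\<close>
  have "cv_wmean t x y = cv_mean x (cv_wmean (2 * t) x y)" for t
    using half[of 0 "2 * t"] by (simp add: cv_wmean_0 assms)
  moreover have "cv_wmean t x y = cv_mean (cv_wmean (2 * t - 1) x y) y" for t
    using half[of "2 * t - 1" 1] by (simp add: cv_wmean_1 assms)
  ultimately show ?thesis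
    using mean half by blast
qed

end
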